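(* Let $(R,v)$ be a discrete valuation domain. Let $f=a_0+a_1x+\cdots+a_nx^n\in R[x]$ be a primitive polynomial such that there exist indices $j$ and $\ell$ with $1\leq \ell+1\leq j\leq n$ for which the following hold: (i) $v(a_j)=0$; (ii) $\frac{v(a_\ell)}{j-\ell}<\frac{v(a_i)}{j-i}$ for each $i=0,1,\ldots,j-1$ with $i\neq \ell$; (iii) $\gcd(v(a_\ell),\,j-\ell)=1$. Then in any factorization $f(x)=f_1(x)f_2(x)$ of $f$ in $R[x]$, at least one of $f_1,f_2$ has degree $\geq j-\ell$. In particular, if $j=n$ and $\ell=0$, then $f$ is irreducible in $R[x]$.
   Context: A discrete valuation domain $(R,v)$ is an integral domain $R$ which is the valuation ring of a discrete valuation $v$ (with values in $\mathbb{Z}\cup\{\infty\}$, $v(0)=\infty$) on its field of fractions; thus $v\geq 0$ on $R$. A polynomial over $R$ is primitive if its coefficients are not all divisible by a uniformizer, i.e. $\min_i v(a_i)=0$. *)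

theory Defs
  imports
    "HOL-Computational_Algebra.Polynomial_Factorial"
    "HOL-Library.Extended_Real"
begin

(* Values in the integers together with \<infinity> are taken inside ereal. The image clause says
   both that nonzero elements have integer values and that v is normalized (onto the integers). *)
definition discrete_valuation :: "('k::field \<Rightarrow> ereal) \<Rightarrow> bool" where
  "discrete_valuation v \<longleftrightarrow>
     v 0 = \<infinity> \<and>
     v ` (- {0}) = range (\<lambda>k::int. ereal (real_of_int k)) \<and>
     (\<forall>x y. v (x * y) = v x + v y) \<and>
     (\<forall>x y. v (x + y) \<ge> min (v x) (v y))"

definition discrete_valuation_domain :: "('a::idom fract \<Rightarrow> ereal) \<Rightarrow> bool" where
  "discrete_valuation_domain v \<longleftrightarrow>
     discrete_valuation v \<and> range (to_fract :: 'a \<Rightarrow> 'a fract) = {x. v x \<ge> 0}"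

abbreviation val :: "('a::idom fract \<Rightarrow> ereal) \<Rightarrow> 'a \<Rightarrow> ereal" where
  "val v a \<equiv> v (to_fract a)"

definition primitive_poly :: "('a::idom fract \<Rightarrow> ereal) \<Rightarrow> 'a poly \<Rightarrow> bool" where
  "primitive_poly v f \<longleftrightarrow> (MIN i\<in>{..degree f}. val v (coeff f i)) = 0"

end

theory Submission
  imports Defs
begin

text \<open>
  Put d = j - l and let m = v(a_l). For m > 0, the weight d v(a_i) + m i attains its minimum over
  the support of f exactly at i = l and i = j (the Newton polygon has an edge there without
  interior lattice points). As in Gauss's lemma, the first minimizing indices of two factors add up
  to the first minimizing index of the product, and so do the last ones. If l1 and j1 are the first
  and the last minimizing index of a factor, comparing weights gives d | m (j1 - l1), hence
  d | j1 - l1. The two differences add up to d, so one of them is at least d.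
  If m = 0, the coprimality forces d = 1.
\<close>

section \<open>Valuations with integer values on an integral domain\<close>

text \<open>Integer values allow divisibility arguments and linear arithmetic. They cannot express
  infinity, so \<open>g 0\<close> is arbitrary and both laws are restricted to nonzero
  elements.\<close>

locale int_valuation =
  fixes g :: "'a::idom \<Rightarrow> int"
  assumes mult: "\<lbrakk>x \<noteq> 0; y \<noteq> 0\<rbrakk> \<Longrightarrow> g (x * y) = g x + g y"
    and add: "\<lbrakk>x \<noteq> 0; y \<noteq> 0; x + y \<noteq> 0\<rbrakk> \<Longrightarrow> min (g x) (g y) \<le> g (x + y)"
begin

lemma one: "g 1 = 0"
  using mult[of 1 1] by simp

lemma uminus: "g (- x) = g x"
proof (cases "x = 0")
  case False
  have "g (- 1) = 0"
    using mult[of "- 1" "- 1"] one by simp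
  then show ?thesis
    using mult[of "- 1" x] False by simp
qed simp

text \<open>If \<open>g (x + y)\<close> exceeded \<open>g x\<close>, then
  \<open>x = (x + y) + (- y)\<close> would have a value above its own. The conditional premise lets
  \<open>y = 0\<close> count as having infinite value.\<close>

lemma add_dominant:
  assumes "x \<noteq> 0" and y: "y \<noteq> 0 \<Longrightarrow> g x < g y"
  shows "x + y \<noteq> 0" and "g (x + y) = g x"
proof -
  have "x + y \<noteq> 0 \<and> g (x + y) = g x"
  proof (cases "y = 0")
    case False
    have nz: "x + y \<noteq> 0"
      using y uminus[of x] False by (metis add_eq_0_iff less_irrefl)
    have "min (g (x + y)) (g y) \<le> g x"
      using add[of "x + y" "- y"] nz False assms(1) uminus[of y] by simp
    then show ?thesis
      using nz add[of x y] False assms(1) y by auto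
  qed (use assms(1) in simp)
  then show "x + y \<noteq> 0" "g (x + y) = g x" by auto
qed

text \<open>The iterated ultrametric inequality, phrased with a witness because a minimum over all
  summands would involve the arbitrary \<open>g 0\<close>.\<close>

lemma sum_ge_summand:
  assumes "finite A" and "sum h A \<noteq> 0"
  shows "\<exists>i\<in>A. h i \<noteq> 0 \<and> g (h i) \<le> g (sum h A)"
  using assms
proof (induction A rule: finite_induct)
  case (insert a A)
  consider "h a = 0" | "sum h A = 0" | "h a \<noteq> 0" "sum h A \<noteq> 0" by blast
  then show ?case
  proof cases
    case 3
    then have "min (g (h a)) (g (sum h A)) \<le> g (sum h (insert a A))"
      using add[of "h a" "sum h A"] insert by simp
    then show ?thesis
      using insert.IH 3 by (force simp: min_le_iff_disj)
  qed (use insert in auto)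
qed simp

section \<open>Weights and extremal indices\<close>

text \<open>Points \<open>(i, g (coeff p i))\<close> of equal weight lie on a line of slope
  \<open>- m / d\<close>; minimal weight thus singles out a piece of the Newton polygon without any
  division.\<close>

definition weight :: "int \<Rightarrow> int \<Rightarrow> 'a poly \<Rightarrow> nat \<Rightarrow> int" where
  "weight d m p i = d * g (coeff p i) + m * int i"

text \<open>The sign of \<open>s\<close> decides whether \<open>a\<close> is the first (\<open>s > 0\<close>) or the last (\<open>s < 0\<close>) index
  of minimal weight.\<close>

definition extremal :: "int \<Rightarrow> int \<Rightarrow> int \<Rightarrow> 'a poly \<Rightarrow> nat \<Rightarrow> bool" where
  "extremal d m s p a \<longleftrightarrow> coeff p a \<noteq> 0 \<and>
     (\<forall>i. coeff p i \<noteq> 0 \<longrightarrow> weight d m p a \<le> weight d m p i \<and>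
        (s * int i < s * int a \<longrightarrow> weight d m p a < weight d m p i))"

text \<open>A lexicographic minimum over the finite support: first of the weight, then of
  \<open>s * i\<close>.\<close>

lemma extremal_exists:
  assumes "p \<noteq> 0"
  shows "\<exists>a. extremal d m s p a"
proof -
  define S where "S = {i. coeff p i \<noteq> 0}"
  have fin: "finite S"
    unfolding S_def by (rule finite_subset[of _ "{..degree p}"]) (auto intro: le_degree)
  have "S \<noteq> {}"
    unfolding S_def using assms leading_coeff_0_iff by blast
  define b where "b = arg_min_on (weight d m p) S"
  have b: "b \<in> S" "\<And>i. i \<in> S \<Longrightarrow> weight d m p b \<le> weight d m p i"
    using arg_min_if_finite[OF fin \<open>S \<noteq> {}\<close>, of "weight d m p"] unfolding b_def
    by (auto simp: not_less)
  define T where "T = {i \<in> S. weight d m p i = weight d m p b}"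
  have T: "finite T" "T \<noteq> {}"
    using fin b(1) by (auto simp: T_def)
  define a where "a = arg_min_on (\<lambda>i. s * int i) T"
  have a: "a \<in> T" "\<And>i. i \<in> T \<Longrightarrow> s * int a \<le> s * int i"
    using arg_min_if_finite[OF T, of "\<lambda>i. s * int i"] unfolding a_def by (auto simp: not_less)
  have "extremal d m s p a"
    unfolding extremal_def
  proof (intro conjI allI impI)
    show "coeff p a \<noteq> 0"
      using a(1) by (auto simp: T_def S_def)
  next
    fix i assume "coeff p i \<noteq> 0"
    then show "weight d m p a \<le> weight d m p i"
      using a(1) b(2)[of i] by (auto simp: T_def S_def)
  next
    fix i assume "coeff p i \<noteq> 0" and "s * int i < s * int a"
    then have "i \<in> S" "i \<notin> T"
      using a(2)[of i] by (auto simp: S_def)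
    then show "weight d m p a < weight d m p i"
      using a(1) b(2)[of i] by (auto simp: T_def)
  qed
  then show ?thesis ..
qed

text \<open>In coefficient \<open>a + b\<close> of the product, the term with \<open>i = a\<close>
  has strictly smaller value than every other nonzero term, so it cannot be cancelled.\<close>

lemma extremal_mult:
  assumes d: "d > 0" and s: "s \<noteq> 0"
    and a: "extremal d m s p a" and b: "extremal d m s q b"
  shows "extremal d m s (p * q) (a + b)"
proof -
  let ?w = "weight d m"
  let ?t = "\<lambda>k i. coeff p i * coeff q (k - i)"
  have weight_term: "d * g (?t k i) + m * int k = ?w p i + ?w q (k - i)"
    if "i \<le> k" "?t k i \<noteq> 0" for i k
    using that mult[of "coeff p i" "coeff q (k - i)"]
    by (simp add: weight_def of_nat_diff algebra_simps)
  have ge: "?w p a + ?w q b \<le> ?w p i + ?w q (k - i)" if "?t k i \<noteq> 0" for i k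
    using that a b unfolding extremal_def by (simp add: add_mono)
  have gt: "?w p a + ?w q b < ?w p i + ?w q (k - i)"
    if "?t k i \<noteq> 0" "s * int i < s * int a \<or> s * int (k - i) < s * int b" for i k
    using that a b unfolding extremal_def by (auto intro: add_less_le_mono add_le_less_mono)

  have nz: "?t (a + b) a \<noteq> 0"
    using a b by (simp add: extremal_def)
  let ?rest = "\<Sum>i\<in>{..a + b} - {a}. ?t (a + b) i"
  have coeff_eq: "coeff (p * q) (a + b) = ?t (a + b) a + ?rest"
    by (simp add: coeff_mult sum.remove[of "{..a + b}" a])
  have dom: "g (?t (a + b) a) < g ?rest" if rest: "?rest \<noteq> 0"
  proof -
    obtain i where i: "i \<le> a + b" "i \<noteq> a" "?t (a + b) i \<noteq> 0" "g (?t (a + b) i) \<le> g ?rest"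
      using sum_ge_summand[OF _ rest] by auto
    \<comment> \<open>The indices \<open>i\<close> and \<open>a + b - i\<close> deviate from
      \<open>a\<close> and \<open>b\<close> by opposite amounts, so one of them passes its extremal
      index in the direction given by \<open>s\<close>.\<close>
    have "s * int i < s * int a \<or> s * int (a + b - i) < s * int b"
      using i(1,2) s by (cases "s > 0") (auto simp: mult_less_cancel_left)
    then have "?w p a + ?w q b < ?w p i + ?w q (a + b - i)"
      using gt i(3) by blast
    then have "d * g (?t (a + b) a) < d * g (?t (a + b) i)"
      using weight_term[OF i(1,3)] weight_term[of a "a + b", OF _ nz] by simp
    then show ?thesis
      using d i(4) by simp
  qed
  have c: "coeff (p * q) (a + b) \<noteq> 0" "g (coeff (p * q) (a + b)) = g (?t (a + b) a)"
    unfolding coeff_eq using add_dominant[OF nz dom] by blast+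
  have w: "?w (p * q) (a + b) = ?w p a + ?w q b"
    using weight_term[of a "a + b", OF _ nz] c(2) by (simp add: weight_def)
  show ?thesis
    unfolding extremal_def
  proof (intro conjI allI impI)
    show "coeff (p * q) (a + b) \<noteq> 0" by (fact c(1))
  next
    fix k assume k: "coeff (p * q) k \<noteq> 0"
    \<comment> \<open>Cancellation can only raise the value, so the weight at \<open>k\<close> is
      bounded below by that of a single term.\<close>
    obtain i where i: "i \<le> k" "?t k i \<noteq> 0" "g (?t k i) \<le> g (coeff (p * q) k)"
      using sum_ge_summand[of "{..k}" "?t k"] k by (auto simp: coeff_mult)
    have le: "?w p i + ?w q (k - i) \<le> ?w (p * q) k"
      unfolding weight_term[OF i(1,2), symmetric] weight_def[of d m "p * q"]
      using i(3) d by simp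
    show "?w (p * q) (a + b) \<le> ?w (p * q) k"
      using w le ge[OF i(2)] by simp
    assume "s * int k < s * int (a + b)"
    \<comment> \<open>Since \<open>i\<close> and \<open>k - i\<close> add up to \<open>k\<close>,
      they cannot both stay on the far side of \<open>a\<close> and \<open>b\<close>.\<close>
    then have "s * int i + s * int (k - i) < s * int a + s * int b"
      using i(1) by (simp add: of_nat_diff algebra_simps)
    then have "s * int i < s * int a \<or> s * int (k - i) < s * int b"
      by linarith
    then show "?w (p * q) (a + b) < ?w (p * q) k"
      using w le gt[OF i(2)] by simp
  qed
qed

text \<open>Whatever the signs \<open>s\<close> and \<open>t\<close>, both indices attain the
  minimal weight; equating the two weights makes \<open>m * (b - a)\<close> a multiple of
  \<open>d\<close>.\<close>

lemma dvd_extremal_diff: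
  assumes "coprime m d" and "extremal d m s p a" and "extremal d m t p b"
  shows "d dvd int b - int a"
proof -
  have "weight d m p a = weight d m p b"
    using assms(2,3) by (meson extremal_def order_antisym)
  then have "m * (int b - int a) = d * (g (coeff p a) - g (coeff p b))"
    by (simp add: weight_def algebra_simps)
  then have "d dvd m * (int b - int a)" by simp
  then show ?thesis
    using assms(1) by (simp add: coprime_dvd_mult_right_iff coprime_commute)
qed

lemma degree_factor_ge:
  assumes lj: "l < j" and cop: "coprime m (int (j - l))"
    and l: "coeff (p * q) l \<noteq> 0" and j: "coeff (p * q) j \<noteq> 0"
    and eq: "weight (int (j - l)) m (p * q) l = weight (int (j - l)) m (p * q) j"
    and less: "\<And>i. \<lbrakk>coeff (p * q) i \<noteq> 0; i \<noteq> l; i \<noteq> j\<rbrakk> \<Longrightarrow>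
      weight (int (j - l)) m (p * q) j < weight (int (j - l)) m (p * q) i"
  shows "j - l \<le> degree p \<or> j - l \<le> degree q"
proof -
  let ?d = "int (j - l)"
  have d: "?d > 0" using lj by simp
  have nz: "p \<noteq> 0" "q \<noteq> 0" using l by auto
  obtain l1 l2 j1 j2 where ext:
    "extremal ?d m 1 p l1" "extremal ?d m 1 q l2" "extremal ?d m (-1) p j1" "extremal ?d m (-1) q j2"
    using extremal_exists nz by meson
  \<comment> \<open>By \<open>less\<close>, only \<open>l\<close> and \<open>j\<close> have minimal
    weight; as \<open>l < j\<close>, the sign selects one of them.\<close>
  have first: "i = l" if "extremal ?d m 1 (p * q) i" for i
    using that l j eq less[of i] lj unfolding extremal_def
    by (metis less_irrefl mult_1 not_less of_nat_less_iff)
  have last: "i = j" if "extremal ?d m (-1) (p * q) i" for i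
  proof -
    have "\<not> - 1 * int j < - 1 * int i"  "\<not> weight ?d m (p * q) j < weight ?d m (p * q) i"
      using that l j eq less[of i] unfolding extremal_def by (metis less_irrefl not_less)+
    then show ?thesis
      using that eq less[of i] lj unfolding extremal_def by fastforce
  qed
  have "l1 + l2 = l"
    using first extremal_mult[OF d _ ext(1,2)] by simp
  moreover have "j1 + j2 = j"
    using last extremal_mult[OF d _ ext(3,4)] by simp
  ultimately have "(int j1 - int l1) + (int j2 - int l2) = ?d"
    using lj by simp
  then have "int j1 - int l1 > 0 \<or> int j2 - int l2 > 0"
    using d by linarith
  moreover have "?d dvd int j1 - int l1" "?d dvd int j2 - int l2"
    using dvd_extremal_diff[OF cop] ext by blast+
  \<comment> \<open>A positive multiple of \<open>?d\<close> is at least \<open>?d\<close>. As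
    \<open>l1\<close> and \<open>l2\<close> are natural numbers, this bounds \<open>j1\<close> or
    \<open>j2\<close> from below, and these index nonzero coefficients.\<close>
  ultimately have "?d \<le> int j1 - int l1 \<or> ?d \<le> int j2 - int l2"
    using zdvd_imp_le by blast
  moreover have "j1 \<le> degree p" "j2 \<le> degree q"
    using ext(3,4) by (auto simp: extremal_def intro: le_degree)
  ultimately show ?thesis by linarith
qed

end

section \<open>Units of a discrete valuation domain\<close>

lemma discrete_valuation_one:
  assumes "discrete_valuation v"
  shows "v 1 = 0"
proof -
  \<comment> \<open>Finiteness comes first, since infinite values also satisfy
    \<open>v 1 = v 1 + v 1\<close>.\<close>
  have "v 1 \<in> range (\<lambda>k::int. ereal (real_of_int k))"
    using assms unfolding discrete_valuation_def by (metis ComplI image_eqI singletonD zero_neq_one)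
  moreover have "v 1 = v 1 + v 1"
    using assms unfolding discrete_valuation_def by (metis mult_1)
  ultimately show ?thesis by auto
qed

text \<open>The inverse in the fraction field also has value 0, and the ring contains every element
  of nonnegative value.\<close>

lemma discrete_valuation_domain_unit:
  assumes v: "discrete_valuation_domain v" and c: "val v c = 0"
  shows "c dvd 1"
proof -
  have dv: "discrete_valuation v" and R: "range to_fract = {x. v x \<ge> 0}"
    using v by (auto simp: discrete_valuation_domain_def)
  have nz: "to_fract c \<noteq> 0"
    using c dv unfolding discrete_valuation_def by auto
  have "v (to_fract c * inverse (to_fract c)) = val v c + v (inverse (to_fract c))"
    using dv unfolding discrete_valuation_def by blast
  then have "v (inverse (to_fract c)) = 0"
    using nz c discrete_valuation_one[OF dv] by simp
  then obtain e where "inverse (to_fract c) = to_fract e"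
    using R by (metis (mono_tags, lifting) image_iff mem_Collect_eq order_refl)
  then have "to_fract (c * e) = to_fract 1"
    using nz by (metis right_inverse to_fract_1 to_fract_mult)
  then have "c * e = 1" by (simp only: to_fract_eq_iff)
  then show ?thesis by (metis dvd_triv_left)
qed

theorem theorem1:
  fixes v :: "'a::idom fract \<Rightarrow> ereal"
    and f :: "'a poly"
    and n j l :: nat
    and m :: int
  assumes "discrete_valuation_domain v"
    and "degree f = n"
    and "primitive_poly v f"
    and "1 \<le> l + 1" and "l + 1 \<le> j" and "j \<le> n"
    and "val v (coeff f j) = 0"
    and "\<forall>i<j. i \<noteq> l \<longrightarrow>
           val v (coeff f l) / ereal (real (j - l)) < val v (coeff f i) / ereal (real (j - i))"
    and "val v (coeff f l) = ereal (real_of_int m)" and "gcd m (int (j - l)) = 1"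
  shows "(\<forall>f1 f2. f = f1 * f2 \<longrightarrow> degree f1 \<ge> j - l \<or> degree f2 \<ge> j - l) \<and>
         (j = n \<and> l = 0 \<longrightarrow> irreducible f)"
proof -
  have dv: "discrete_valuation v" and R: "range (to_fract :: 'a \<Rightarrow> 'a fract) = {x. v x \<ge> 0}"
    using assms(1) by (auto simp: discrete_valuation_domain_def)
  have nonneg: "val v a \<ge> 0" for a
    using R by auto
  have v0: "v 0 = \<infinity>" and v_mult: "\<And>x y. v (x * y) = v x + v y"
    and v_add: "\<And>x y. min (v x) (v y) \<le> v (x + y)"
    using dv unfolding discrete_valuation_def by auto
  have "\<exists>k::int. val v a = ereal (real_of_int k)" if "a \<noteq> 0" for a
  proof -
    have "val v a \<in> v ` (- {0})" using that by simp
    then show ?thesis using dv unfolding discrete_valuation_def by auto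
  qed
  then obtain g :: "'a \<Rightarrow> int" where g: "\<And>a. a \<noteq> 0 \<Longrightarrow> val v a = ereal (real_of_int (g a))"
    by metis
  interpret int_valuation g
  proof
    fix x y :: 'a assume x: "x \<noteq> 0" and y: "y \<noteq> 0"
    have "ereal (real_of_int (g (x * y))) = ereal (real_of_int (g x)) + ereal (real_of_int (g y))"
      using v_mult[of "to_fract x" "to_fract y"] g[of "x * y"] g[OF x] g[OF y] x y
      by (simp del: plus_ereal.simps)
    then have "real_of_int (g (x * y)) = real_of_int (g x + g y)"
      by simp
    then show "g (x * y) = g x + g y"
      by (simp only: of_int_eq_iff)
    assume xy: "x + y \<noteq> 0"
    show "min (g x) (g y) \<le> g (x + y)"
      using v_add[of "to_fract x" "to_fract y"] g[OF xy] g[OF x] g[OF y]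
      by (simp add: min_le_iff_disj)
  qed
  have lj: "l < j" using assms(5) by simp
  define d where "d = int (j - l)"
  have d: "d > 0" using lj by (simp add: d_def)
  have aj: "coeff f j \<noteq> 0" and al: "coeff f l \<noteq> 0"
    using assms(7,9) v0 by auto
  have gj: "g (coeff f j) = 0" and gl: "g (coeff f l) = m"
    using g[OF aj] g[OF al] assms(7,9) by auto
  have "0 \<le> m" using nonneg[of "coeff f l"] assms(9) by simp
  \<comment> \<open>Hypothesis (ii) with denominators cleared; adding \<open>m * i\<close> to both
    sides compares the weights at \<open>j\<close> and \<open>i\<close>, as
    \<open>g (coeff f j) = 0\<close>.\<close>
  have slope: "m * int (j - i) < d * g (coeff f i)" if "i < j" "i \<noteq> l" "coeff f i \<noteq> 0" for i
  proof -
    have "real_of_int m / real (j - l) < real_of_int (g (coeff f i)) / real (j - i)"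
      using assms(8) that lj g[OF that(3)] assms(9) by auto
    then have "real_of_int m * real (j - i) < real_of_int (g (coeff f i)) * real (j - l)"
      using that lj by (simp add: field_simps del: of_nat_diff)
    then have "real_of_int (m * int (j - i)) < real_of_int (d * g (coeff f i))"
      by (simp add: d_def mult.commute del: of_nat_diff)
    then show ?thesis by (simp only: of_int_less_iff)
  qed
  have factor: "degree f1 \<ge> j - l \<or> degree f2 \<ge> j - l" if f: "f = f1 * f2" for f1 f2
  proof (cases "m = 0")
    \<comment> \<open>For \<open>m = 0\<close> the weight ignores the index, so a unit coefficient
      beyond \<open>j\<close> would tie with the one at \<open>j\<close>. Since
      \<open>d = 1\<close>, it suffices that some factor is nonconstant.\<close>
    case True
    then have "j - l = 1" using assms(10) by simp
    moreover have "degree f \<le> degree f1 + degree f2"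
      using f degree_mult_le by blast
    ultimately show ?thesis
      using assms(2,6) lj by linarith
  next
    case False
    show ?thesis
    proof (rule degree_factor_ge[OF lj, of m])
      show "coprime m (int (j - l))"
        using assms(10) by (simp only: coprime_iff_gcd_eq_1)
      show "weight (int (j - l)) m (f1 * f2) l = weight (int (j - l)) m (f1 * f2) j"
        using lj gl gj by (simp add: weight_def f[symmetric] of_nat_diff algebra_simps)
    next
      fix i assume "coeff (f1 * f2) i \<noteq> 0" and i: "i \<noteq> l" "i \<noteq> j"
      then have nz: "coeff f i \<noteq> 0" using f by simp
      have "m * int j < d * g (coeff f i) + m * int i"
      proof (cases "i < j")
        case True
        then show ?thesis
          using slope[OF True i(1) nz] by (simp add: of_nat_diff algebra_simps)
      next
        \<comment> \<open>Beyond \<open>j\<close>, hypothesis (ii) is silent; nonnegative values and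
          \<open>m > 0\<close> give the strict inequality.\<close>
        case False
        have "0 \<le> g (coeff f i)"
          using nonneg[of "coeff f i"] g[OF nz] by simp
        moreover have "m * int j < m * int i"
          using False i \<open>0 \<le> m\<close> \<open>m \<noteq> 0\<close> by simp
        ultimately show ?thesis
          using d by (simp add: add_nonneg_pos add_strict_increasing2)
      qed
      then show "weight (int (j - l)) m (f1 * f2) j < weight (int (j - l)) m (f1 * f2) i"
        using gj by (simp add: weight_def f[symmetric] d_def)
    qed (use al aj f in auto)
  qed
  have "irreducible f" if "j = n" "l = 0"
  proof (rule irreducibleI)
    have const_unit: "p dvd 1" if pq: "f = p * q" and "degree p = 0" for p q
    proof -
      obtain c where c: "p = [:c:]"
        using \<open>degree p = 0\<close> degree_eq_zeroE by blast
      \<comment> \<open>The constant \<open>c\<close> divides the leading coefficient, which has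
        value 0; two nonnegative values with sum 0 both vanish.\<close>
      have "val v c + val v (coeff q n) = 0"
        using assms(7) \<open>j = n\<close> pq c v_mult[of "to_fract c" "to_fract (coeff q n)"] by simp
      then have "val v c = 0"
        using nonneg[of c] nonneg[of "coeff q n"] by (simp add: add_nonneg_eq_0_iff)
      then show ?thesis
        using discrete_valuation_domain_unit[OF assms(1)] c by (simp add: is_unit_const_poly_iff)
    qed
    show "f \<noteq> 0" using aj by auto
    show "\<not> f dvd 1"
      using assms(2,6) lj by (auto elim: is_unit_polyE)
    fix p q assume pq: "f = p * q"
    then have "p \<noteq> 0" "q \<noteq> 0" using aj by auto
    then have "degree p + degree q = n"
      using assms(2) pq degree_mult_eq by metis
    \<comment> \<open>Here \<open>j - l = n\<close>, so one factor takes up the whole degree and the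
      other is constant.\<close>
    then have "degree p = 0 \<or> degree q = 0"
      using factor[OF pq] that by auto
    then show "p dvd 1 \<or> q dvd 1"
      using const_unit[of p q] const_unit[of q p] pq by (auto simp: mult.commute)
  qed
  then show ?thesis using factor by blast
qed

end
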